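(* Let $X$ be an $n$-Hilbert space, let $a_2,\dots,a_n\in X$ be fixed, let $X_F$ be the associated Hilbert space, and let $K\in\mathcal B(X_F)$. Let $\{f_i\}_{i=1}^\infty$ and $\{g_i\}_{i=1}^\infty$ in $X$ be $K$-frames associated to $(a_2,\dots,a_n)$ for $X$ with corresponding pre-frame operators $T$ and $L$, respectively. If $TL^*$ and $LT^*$ are positive operators on $X_F$, then $\{f_i+g_i\}_{i=1}^\infty$ is also a $K$-frame associated to $(a_2,\dots,a_n)$ for $X$.
   Context: Setting. Let $n\ge 2$ and let $X$ be a linear space over $\mathbb K\in\{\mathbb R,\mathbb C\}$ of dimension at least $n$. An $n$-inner product on $X$ is a map $\langle\cdot,\cdot\,|\,\cdot,\dots,\cdot\rangle:X^{n+1}\to\mathbb K$ such that: (I) $\langle x_1,x_1|x_2,\dots,x_n\rangle\ge 0$, with equality iff $x_1,\dots,x_n$ are linearly dependent; (II) $\langle x,y|x_2,\dots,x_n\rangle$ is invariant under permutations of $x_2,\dots,x_n$; (III) $\langle x,y|x_2,\dots,x_n\rangle=\overline{\langle y,x|x_2,\dots,x_n\rangle}$; (IV),(V) it is linear in the first variable. It induces the $n$-norm $\|x_1,x_2,\dots,x_n\|=\sqrt{\langle x_1,x_1|x_2,\dots,x_n\rangle}$. A sequence $\{x_k\}$ in $X$ converges to $x$ if $\|x_k-x,x_2,\dots,x_n\|\to 0$ for all $x_2,\dots,x_n\in X$, and is Cauchy if $\|x_l-x_k,x_2,\dots,x_n\|\to0$ as $l,k\to\infty$ for all $x_2,\dots,x_n\in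 X$; $X$ is an $n$-Hilbert space if every Cauchy sequence converges. Let $X$ be an $n$-Hilbert space, $a_2,\dots,a_n\in X$ fixed linearly independent vectors, $F=\{a_2,\dots,a_n\}$, and $L_F$ the span of $F$. Then $\langle x+L_F,y+L_F\rangle_F=\langle x,y|a_2,\dots,a_n\rangle$ is an inner product on $X/L_F$ (identified with an algebraic complement $M_F$ of $L_F$ in $X$), and $X_F$ denotes its Hilbert space completion. Elements of $X$ are regarded as elements of $X_F$ through the canonical map $X\to X/L_F\to X_F$. For $f,g\in X_F$ write $\langle f,g|a_2,\dots,a_n\rangle=\langle f,g\rangle_F$ and $\|f,a_2,\dots,a_n\|=\|f\|_F$ for the inner product and norm of $X_F$. $\mathcal B(X_F)$ is the space of bounded linear operators on $X_F$, and $l^2(\mathbb N)$ is the Hilbert space of square-summable $\mathbb K$-valued sequences. For $K\in\mathcal B(X_F)$, a sequence $\{f_i\}_{i=1}^\infty$ in $X$ (or in $X_F$) is a $K$-frame associated to $(a_2,\dots,a_n)$ for $X$ if there are constants $0<A\le B<\infty$ (called bounds) such that for all $f\in X_F$ $$A\|K^*f,a_2,\dots,a_n\|^2\le\sum_{i=1}^\infty|\langle f,f_i|a_2,\dots,a_n\rangle|^2\le B\|f,a_2,\dots,a_n\|^2 .$$ The pre-frame operator of such a sequence is the bounded linear operator $T:l^2(\mathbb N)\to X_F$, $T\{c_i\}=\sum_{i=1}^\infty c_if_i$; its adjoint is $T^*f=\{\langle f,f_i|a_2,\dots,a_n\rangle\}_{i=1}^\infty$. *)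

theory Defs
  imports "HOL-Analysis.Analysis" "HOL-Library.Multiset"
begin

text \<open>
  The scalar fields: up to the isometric embedding \<open>to_complex\<close>, an instance of this class
  is either the field of reals or the field of complex numbers.
\<close>

class real_or_complex = real_normed_field +
  fixes to_complex :: "'a \<Rightarrow> complex"
  assumes to_complex_add: "to_complex (x + y) = to_complex x + to_complex y"
    and to_complex_mult: "to_complex (x * y) = to_complex x * to_complex y"
    and to_complex_scaleR: "to_complex (r *\<^sub>R x) = r *\<^sub>R to_complex x"
    and norm_to_complex: "norm (to_complex x) = norm x"
    and range_to_complex: "range to_complex = \<real> \<or> range to_complex = UNIV"

instantiation real :: real_or_complex
begin
definition "to_complex (x :: real) = complex_of_real x"
instance
  by standard (auto simp: to_complex_real_def scaleR_conv_of_real Reals_def)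
end

instantiation complex :: real_or_complex
begin
definition "to_complex (x :: complex) = x"
instance
  by standard (auto simp: to_complex_complex_def)
end

definition kconj :: "'k::real_or_complex \<Rightarrow> 'k" where
  "kconj x = inv to_complex (cnj (to_complex x))"

lemma to_complex_kconj: "to_complex (kconj x) = cnj (to_complex x)"
proof -
  have "cnj (to_complex x) \<in> range (to_complex :: 'a \<Rightarrow> complex)"
    using range_to_complex rangeI[of to_complex x]
    by (metis Reals_cnj_iff UNIV_I complex_cnj_cnj)
  then show ?thesis
    unfolding kconj_def by (rule f_inv_into_f)
qed

text \<open>
  \<open>nip x y [x\<^sub>2, \<dots>, x\<^sub>n]\<close> stands for \<open>\<langle>x, y | x\<^sub>2, \<dots>, x\<^sub>n\<rangle>\<close>; its values at lists of length other
  than \<open>n - 1\<close> are irrelevant.  Linear dependence is that of a family, so that a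
  family with a repeated member is dependent.
\<close>

locale n_inner_product_space = vector_space scale
  for scale :: "'k::real_or_complex \<Rightarrow> 'a::ab_group_add \<Rightarrow> 'a" +
  fixes n :: nat and nip :: "'a \<Rightarrow> 'a \<Rightarrow> 'a list \<Rightarrow> 'k"
  assumes two_le_n: "2 \<le> n"
    and dimension_ge_n: "\<exists>B. independent B \<and> card B = n"
    and nip_nonneg: "length xs = n - 1 \<Longrightarrow> nip x x xs \<in> \<real>\<^sub>\<ge>\<^sub>0"
    and nip_eq_0_iff: "length xs = n - 1 \<Longrightarrow>
      nip x x xs = 0 \<longleftrightarrow> \<not> (distinct (x # xs) \<and> independent (set (x # xs)))"
    and nip_permute: "length xs = n - 1 \<Longrightarrow> mset ys = mset xs \<Longrightarrow> nip x y ys = nip x y xs"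
    and nip_commute: "length xs = n - 1 \<Longrightarrow> nip x y xs = kconj (nip y x xs)"
    and nip_add_left: "length xs = n - 1 \<Longrightarrow> nip (x + y) z xs = nip x z xs + nip y z xs"
    and nip_scale_left: "length xs = n - 1 \<Longrightarrow> nip (scale c x) y xs = c * nip x y xs"
begin

definition n_norm :: "'a \<Rightarrow> 'a list \<Rightarrow> real" where
  "n_norm x xs = sqrt (Re (to_complex (nip x x xs)))"

definition n_converges :: "(nat \<Rightarrow> 'a) \<Rightarrow> 'a \<Rightarrow> bool" where
  "n_converges X x \<longleftrightarrow>
    (\<forall>xs. length xs = n - 1 \<longrightarrow> (\<lambda>k. n_norm (X k - x) xs) \<longlonglongrightarrow> 0)"

definition n_Cauchy :: "(nat \<Rightarrow> 'a) \<Rightarrow> bool" where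
  "n_Cauchy X \<longleftrightarrow>
    (\<forall>xs. length xs = n - 1 \<longrightarrow>
      ((\<lambda>(l, k). n_norm (X l - X k) xs) \<longlongrightarrow> 0) (sequentially \<times>\<^sub>F sequentially))"

end

locale n_hilbert_space = n_inner_product_space scale n nip
  for scale :: "'k::real_or_complex \<Rightarrow> 'a::ab_group_add \<Rightarrow> 'a"
    and n :: nat and nip :: "'a \<Rightarrow> 'a \<Rightarrow> 'a list \<Rightarrow> 'k" +
  assumes n_complete: "n_Cauchy X \<Longrightarrow> \<exists>x. n_converges X x"

text \<open>
  The adjoint of \<open>T\<close>, where the domain of \<open>T\<close> is the inner product space \<open>D\<close> with inner
  product \<open>ipD\<close>, and \<open>ipE\<close> is the inner product of the codomain.
\<close>

definition adjoint_on ::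
    "'d set \<Rightarrow> ('d \<Rightarrow> 'd \<Rightarrow> 'k) \<Rightarrow> ('e \<Rightarrow> 'e \<Rightarrow> 'k) \<Rightarrow> ('d \<Rightarrow> 'e) \<Rightarrow> 'e \<Rightarrow> 'd" where
  "adjoint_on D ipD ipE T y = (THE z. z \<in> D \<and> (\<forall>x\<in>D. ipE (T x) y = ipD x z))"

definition l2 :: "(nat \<Rightarrow> 'k::real_or_complex) set" where
  "l2 = {c. summable (\<lambda>i. (norm (c i))\<^sup>2)}"

definition l2_inner :: "(nat \<Rightarrow> 'k::real_or_complex) \<Rightarrow> (nat \<Rightarrow> 'k) \<Rightarrow> 'k" where
  "l2_inner c d = (\<Sum>i. c i * kconj (d i))"

locale hilbert_space = vector_space scale
  for scale :: "'k::real_or_complex \<Rightarrow> 'h::banach \<Rightarrow> 'h" +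
  fixes ip :: "'h \<Rightarrow> 'h \<Rightarrow> 'k"
  assumes scale_of_real: "scale (of_real r) x = r *\<^sub>R x"
    and ip_commute: "ip x y = kconj (ip y x)"
    and ip_add_left: "ip (x + y) z = ip x z + ip y z"
    and ip_scale_left: "ip (scale c x) y = c * ip x y"
    and ip_self: "ip x x = of_real ((norm x)\<^sup>2)"
begin

definition bounded_operator :: "('h \<Rightarrow> 'h) \<Rightarrow> bool" where
  "bounded_operator U \<longleftrightarrow> bounded_linear U \<and> (\<forall>c x. U (scale c x) = scale c (U x))"

text \<open>
  Self-adjointness is automatic over the complex numbers; over the reals it is not required.
\<close>

definition positive_operator :: "('h \<Rightarrow> 'h) \<Rightarrow> bool" where
  "positive_operator U \<longleftrightarrow> bounded_operator U \<and> (\<forall>x. ip (U x) x \<in> \<real>\<^sub>\<ge>\<^sub>0)"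

text \<open>
  Summability is stated explicitly because \<^const>\<open>suminf\<close> has no meaning for a divergent series.
\<close>

definition k_frame :: "('h \<Rightarrow> 'h) \<Rightarrow> (nat \<Rightarrow> 'h) \<Rightarrow> bool" where
  "k_frame K f \<longleftrightarrow>
    (\<exists>A B. 0 < A \<and> A \<le> B \<and>
      (\<forall>x. summable (\<lambda>i. (norm (ip x (f i)))\<^sup>2) \<and>
           A * (norm (adjoint_on UNIV ip ip K x))\<^sup>2 \<le> (\<Sum>i. (norm (ip x (f i)))\<^sup>2) \<and>
           (\<Sum>i. (norm (ip x (f i)))\<^sup>2) \<le> B * (norm x)\<^sup>2))"

text \<open>Meaningful at coefficient sequences in \<^const>\<open>l2\<close>.\<close>

definition pre_frame_operator :: "(nat \<Rightarrow> 'h) \<Rightarrow> (nat \<Rightarrow> 'k) \<Rightarrow> 'h" where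
  "pre_frame_operator f c = (\<Sum>i. scale (c i) (f i))"

end

text \<open>
  \<open>emb\<close> is the canonical map of \<open>X\<close> through \<open>X/L\<^sub>F\<close> into a Hilbert space completion
  of \<open>X/L\<^sub>F\<close>.  That it descends to an injection of \<open>X/L\<^sub>F\<close> is derived below
  (\<open>emb_eq_iff\<close>).
\<close>

locale associated_hilbert_space =
  n_hilbert_space scale n nip + H: hilbert_space scaleF ipF
  for scale :: "'k::real_or_complex \<Rightarrow> 'a::ab_group_add \<Rightarrow> 'a"
    and n :: nat and nip :: "'a \<Rightarrow> 'a \<Rightarrow> 'a list \<Rightarrow> 'k"
    and scaleF :: "'k \<Rightarrow> 'h::banach \<Rightarrow> 'h" and ipF :: "'h \<Rightarrow> 'h \<Rightarrow> 'k" +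
  fixes a :: "'a list" and emb :: "'a \<Rightarrow> 'h"
  assumes length_a: "length a = n - 1"
    and distinct_a: "distinct a"
    and independent_a: "independent (set a)"
    and linear_emb: "Vector_Spaces.linear scale scaleF emb"
    and ipF_emb: "ipF (emb x) (emb y) = nip x y a"
    and dense_emb: "closure (range emb) = UNIV"
begin

lemma emb_eq_iff: "emb x = emb y \<longleftrightarrow> x - y \<in> span (set a)"
proof -
  interpret e: Vector_Spaces.linear scale scaleF emb by (rule linear_emb)
  have "emb x = emb y \<longleftrightarrow> emb (x - y) = 0"
    by (simp add: e.diff)
  also have "\<dots> \<longleftrightarrow> ipF (emb (x - y)) (emb (x - y)) = 0"
    by (simp add: H.ip_self)
  also have "\<dots> \<longleftrightarrow> x - y \<in> span (set a)"
    using distinct_a independent_a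
    by (auto simp: ipF_emb nip_eq_0_iff length_a independent_insert span_base)
  finally show ?thesis .
qed

end

end

theory Submission
  imports Defs
begin

text \<open>
  Summing the expansion
  \<open>|\<langle>x, f\<^sub>i + g\<^sub>i\<rangle>|\<^sup>2 = |\<langle>x, f\<^sub>i\<rangle>|\<^sup>2 + |\<langle>x, g\<^sub>i\<rangle>|\<^sup>2 + 2 Re (\<langle>x, g\<^sub>i\<rangle> \<langle>f\<^sub>i, x\<rangle>)\<close> over \<open>i\<close>
  produces the cross term \<open>2 Re \<langle>T L\<^sup>* x, x\<rangle>\<close>, because \<open>L\<^sup>* x\<close> is the sequence of the
  \<open>\<langle>x, g\<^sub>i\<rangle>\<close> and \<open>T\<close> combines the \<open>f\<^sub>i\<close> with these coefficients (\<open>cross_term_sums\<close>).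
  Positivity of \<open>T L\<^sup>*\<close> therefore makes the sum for \<open>f + g\<close> at least the total of the sums
  for \<open>f\<close> and \<open>g\<close>, so that the lower bounds of the two frames add up (\<open>k_frame_add\<close>).  The
  upper bound follows from \<open>|u + v|\<^sup>2 \<le> 2|u|\<^sup>2 + 2|v|\<^sup>2\<close> (\<open>bessel_add\<close>).

  The analytic content is the description of \<open>L\<^sup>*\<close> (\<open>adjoint_pre_frame_operator\<close>).  The adjoint
  is given by a definite description, so the candidate has to be shown both to satisfy the
  adjoint identity and to be the only sequence that does.  The identity rests on the convergence
  of \<open>\<Sum> c\<^sub>i g\<^sub>i\<close> for square-summable \<open>c\<close>, which is where the upper frame bound enters
  (\<open>bessel_summable\<close>), and on the continuity of the inner product.
\<close>

section \<open>Conjugation in the scalar field\<close>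

lemma to_complex_minus: "to_complex (- x :: 'k::real_or_complex) = - to_complex x"
  using to_complex_scaleR[of "-1" x] by simp

lemma to_complex_diff: "to_complex (x - y :: 'k::real_or_complex) = to_complex x - to_complex y"
  using to_complex_add[of x "- y"] by (simp add: to_complex_minus)

lemma to_complex_eq_iff: "to_complex x = to_complex y \<longleftrightarrow> x = (y :: 'k::real_or_complex)"
proof
  assume "to_complex x = to_complex y"
  then have "norm (to_complex (x - y)) = 0"
    by (simp add: to_complex_diff)
  then show "x = y"
    by (simp add: norm_to_complex)
qed simp

lemma to_complex_1: "to_complex (1 :: 'k::real_or_complex) = 1"
proof -
  have "to_complex (1::'k) * to_complex (1::'k) = to_complex (1::'k)"
    by (simp flip: to_complex_mult)
  moreover have "to_complex (1::'k) \<noteq> 0"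
    using norm_to_complex[of "1::'k"] by auto
  ultimately show ?thesis by simp
qed

lemma to_complex_of_real: "to_complex (of_real r :: 'k::real_or_complex) = of_real r"
  using to_complex_scaleR[of r "1::'k"] by (simp add: to_complex_1 scaleR_conv_of_real)

lemma bounded_linear_to_complex: "bounded_linear (to_complex :: 'k::real_or_complex \<Rightarrow> complex)"
  by (rule bounded_linear_intro[where K = 1])
    (simp_all add: to_complex_add to_complex_scaleR norm_to_complex)

lemma kconj_add: "kconj (x + y) = kconj x + kconj y"
  and kconj_mult: "kconj (x * y) = kconj x * kconj y"
  and kconj_kconj: "kconj (kconj x) = x"
  and kconj_of_real: "kconj (of_real r :: 'k) = of_real r"
  for x y :: "'k::real_or_complex"
  by (subst to_complex_eq_iff[symmetric],
      simp add: to_complex_kconj to_complex_add to_complex_mult to_complex_of_real)+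

lemma kconj_0: "kconj (0 :: 'k::real_or_complex) = 0"
  using kconj_of_real[of 0, where ?'k = 'k] by simp

lemma norm_kconj: "norm (kconj x :: 'k::real_or_complex) = norm x"
  by (metis complex_mod_cnj norm_to_complex to_complex_kconj)

lemma mult_kconj: "x * kconj x = (of_real ((norm x)\<^sup>2) :: 'k::real_or_complex)"
  using complex_norm_square[of "to_complex x"]
  by (subst to_complex_eq_iff[symmetric])
    (simp add: to_complex_kconj to_complex_mult to_complex_of_real norm_to_complex
      del: of_real_power)

lemma norm_add_squared:
  "(norm (u + v :: 'k::real_or_complex))\<^sup>2
    = (norm u)\<^sup>2 + (norm v)\<^sup>2 + 2 * Re (to_complex (v * kconj u))"
proof -
  have "(cmod (z + w))\<^sup>2 = (cmod z)\<^sup>2 + (cmod w)\<^sup>2 + 2 * Re (w * cnj z)" for z w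
    unfolding cmod_power2 by (simp add: power2_eq_square algebra_simps)
  from this[of "to_complex u" "to_complex v"] show ?thesis
    by (simp add: to_complex_mult to_complex_kconj norm_to_complex flip: to_complex_add)
qed

section \<open>Continuity of the inner product\<close>

context hilbert_space
begin

lemma ip_zero_left: "ip 0 y = 0"
  using ip_add_left[of 0 0 y] by simp

lemma ip_zero_right: "ip x 0 = 0"
  using ip_commute[of x 0] by (simp add: ip_zero_left kconj_0)

lemma ip_add_right: "ip x (y + z) = ip x y + ip x z"
  by (metis ip_add_left ip_commute kconj_add)

lemma ip_scale_right: "ip x (scale c y) = kconj c * ip x y"
  by (metis ip_commute ip_scale_left kconj_mult)

lemma ip_sum_left: "ip (\<Sum>i\<in>I. u i) y = (\<Sum>i\<in>I. ip (u i) y)"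
  by (induction I rule: infinite_finite_induct) (simp_all add: ip_zero_left ip_add_left)

lemma ip_cauchy_schwarz: "norm (ip x y) \<le> norm x * norm y"
proof (cases "y = 0")
  case False
  define p where "p = ip x y"
  \<comment> \<open>\<open>z\<close> is the component of \<open>x\<close> orthogonal to \<open>y\<close>, multiplied by \<open>\<parallel>y\<parallel>\<^sup>2\<close> to avoid a division.\<close>
  define z where "z = scale (of_real ((norm y)\<^sup>2)) x + scale (- p) y"
  have "ip z y = 0"
    by (simp add: z_def ip_add_left ip_scale_left ip_self p_def del: scale_minus_left)
  then have "ip z z = of_real ((norm y)\<^sup>2) * ip z x"
    by (subst (2) z_def) (simp add: ip_add_right ip_scale_right kconj_of_real
        del: of_real_power scale_minus_left)
  also have "ip z x = of_real ((norm y)\<^sup>2 * (norm x)\<^sup>2 - (norm p)\<^sup>2)"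
    using ip_commute[of y x] mult_kconj[of p]
    by (simp add: z_def ip_add_left ip_scale_left ip_self p_def del: scale_minus_left)
  finally have "of_real ((norm z)\<^sup>2) =
      (of_real ((norm y)\<^sup>2 * ((norm y)\<^sup>2 * (norm x)\<^sup>2 - (norm p)\<^sup>2)) :: 'k)"
    unfolding ip_self by simp
  then have "(norm z)\<^sup>2 = (norm y)\<^sup>2 * ((norm y)\<^sup>2 * (norm x)\<^sup>2 - (norm p)\<^sup>2)"
    unfolding of_real_eq_iff .
  then have "0 \<le> (norm y)\<^sup>2 * ((norm y)\<^sup>2 * (norm x)\<^sup>2 - (norm p)\<^sup>2)"
    by (metis zero_le_power2)
  with False have "(norm p)\<^sup>2 \<le> (norm x * norm y)\<^sup>2"
    by (simp add: zero_le_mult_iff power_mult_distrib mult.commute)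
  then show ?thesis
    unfolding p_def by (rule power2_le_imp_le) simp
qed (simp add: ip_zero_right)

lemma bounded_linear_ip_left: "bounded_linear (\<lambda>x. ip x y)"
proof (rule bounded_linear_intro)
  show "ip (r *\<^sub>R x) y = r *\<^sub>R ip x y" for r x
    by (simp add: ip_scale_left scaleR_conv_of_real flip: scale_of_real)
qed (auto intro: ip_add_left ip_cauchy_schwarz)

section \<open>Synthesis and analysis for Bessel sequences\<close>

text \<open>
  The sign of \<open>B\<close> is part of the definition because in the trivial space the estimate says
  nothing about it, while \<open>\<surd>B\<close> is to serve as a norm bound in every space.
\<close>

definition bessel :: "real \<Rightarrow> (nat \<Rightarrow> 'h) \<Rightarrow> bool" where
  "bessel B f \<longleftrightarrow> 0 \<le> B \<and> (\<forall>x. summable (\<lambda>i. (norm (ip x (f i)))\<^sup>2) \<and>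
      (\<Sum>i. (norm (ip x (f i)))\<^sup>2) \<le> B * (norm x)\<^sup>2)"

text \<open>
  For \<open>s = \<Sum> c\<^sub>i f\<^sub>i\<close>, expanding one argument of \<open>\<langle>s, s\<rangle>\<close> and applying Cauchy-Schwarz to
  the coefficients gives \<open>\<parallel>s\<parallel>\<^sup>2 \<le> \<parallel>c\<parallel> \<surd>B \<parallel>s\<parallel>\<close>, from which a factor \<open>\<parallel>s\<parallel>\<close> cancels.
\<close>

lemma bessel_norm_sum_le:
  assumes "bessel B f" and "finite I"
  shows "norm (\<Sum>i\<in>I. scale (c i) (f i)) \<le> L2_set (\<lambda>i. norm (c i)) I * sqrt B"
proof -
  define s where "s = (\<Sum>i\<in>I. scale (c i) (f i))"
  have "(\<Sum>i\<in>I. (norm (ip s (f i)))\<^sup>2) \<le> (\<Sum>i. (norm (ip s (f i)))\<^sup>2)"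
    using assms by (intro sum_le_suminf) (auto simp: bessel_def)
  also have "\<dots> \<le> B * (norm s)\<^sup>2"
    using assms by (auto simp: bessel_def)
  finally have coeff: "L2_set (\<lambda>i. norm (ip s (f i))) I \<le> sqrt B * norm s"
    unfolding L2_set_def using real_sqrt_le_mono by (fastforce simp: real_sqrt_mult)
  have "(norm s)\<^sup>2 = norm (ip s s)"
    unfolding ip_self by (simp flip: of_real_power)
  also have "ip s s = (\<Sum>i\<in>I. c i * ip (f i) s)"
    by (subst (1) s_def) (simp add: ip_sum_left ip_scale_left)
  also have "norm \<dots> \<le> (\<Sum>i\<in>I. \<bar>norm (c i)\<bar> * \<bar>norm (ip s (f i))\<bar>)"
  proof (rule order_trans[OF norm_sum], rule sum_mono)
    show "norm (c i * ip (f i) s) \<le> \<bar>norm (c i)\<bar> * \<bar>norm (ip s (f i))\<bar>" for i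
      by (subst ip_commute) (simp add: norm_mult norm_kconj)
  qed
  also have "\<dots> \<le> L2_set (\<lambda>i. norm (c i)) I * L2_set (\<lambda>i. norm (ip s (f i))) I"
    by (rule L2_set_mult_ineq)
  also have "\<dots> \<le> L2_set (\<lambda>i. norm (c i)) I * (sqrt B * norm s)"
    by (intro mult_left_mono coeff L2_set_nonneg)
  finally have le: "norm s * norm s \<le> (L2_set (\<lambda>i. norm (c i)) I * sqrt B) * norm s"
    by (simp add: power2_eq_square mult.assoc)
  have "0 \<le> L2_set (\<lambda>i. norm (c i)) I * sqrt B"
    using assms(1) by (simp add: bessel_def L2_set_nonneg)
  with le show ?thesis
    unfolding s_def[symmetric] by (cases "s = 0") simp_all
qed

lemma bessel_summable:
  assumes "bessel B f" and "c \<in> l2"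
  shows "summable (\<lambda>i. scale (c i) (f i))"
proof (rule summable_Cauchy[THEN iffD2], intro allI impI)
  fix e :: real assume "0 < e"
  have B: "0 \<le> B"
    using assms(1) by (simp add: bessel_def)
  \<comment> \<open>\<open>B + 1\<close> instead of \<open>B\<close> avoids a division by zero.\<close>
  define d where "d = e\<^sup>2 / (B + 1)"
  have "0 < d"
    using \<open>0 < e\<close> B by (simp add: d_def)
  then obtain N where N: "norm (\<Sum>i=m..<k. (norm (c i))\<^sup>2) < d" if "m \<ge> N" for m k
    using assms(2) unfolding l2_def summable_Cauchy mem_Collect_eq by blast
  show "\<exists>N. \<forall>m\<ge>N. \<forall>k. norm (\<Sum>i=m..<k. scale (c i) (f i)) < e"
  proof (intro exI allI impI)
    fix m k assume "m \<ge> N"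
    then have tail: "(\<Sum>i=m..<k. (norm (c i))\<^sup>2) < d"
      using N[of m k] by simp
    have "norm (\<Sum>i=m..<k. scale (c i) (f i)) \<le> sqrt ((\<Sum>i=m..<k. (norm (c i))\<^sup>2) * B)"
      using bessel_norm_sum_le[OF assms(1), of "{m..<k}" c]
      by (simp add: L2_set_def real_sqrt_mult)
    also have "\<dots> < sqrt (e\<^sup>2)"
    proof (rule real_sqrt_less_mono)
      have "(\<Sum>i=m..<k. (norm (c i))\<^sup>2) * B \<le> (\<Sum>i=m..<k. (norm (c i))\<^sup>2) * (B + 1)"
        by (intro mult_left_mono sum_nonneg) simp_all
      also have "\<dots> < d * (B + 1)"
        using tail B by (intro mult_strict_right_mono) simp_all
      also have "\<dots> = e\<^sup>2"
        using B by (simp add: d_def)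
      finally show "(\<Sum>i=m..<k. (norm (c i))\<^sup>2) * B < e\<^sup>2" .
    qed
    finally show "norm (\<Sum>i=m..<k. scale (c i) (f i)) < e"
      using \<open>0 < e\<close> by simp
  qed
qed

lemma ip_pre_frame_operator_sums:
  assumes "bessel B f" and "c \<in> l2"
  shows "(\<lambda>i. c i * kconj (ip x (f i))) sums ip (pre_frame_operator f c) x"
proof -
  have "(\<lambda>i. scale (c i) (f i)) sums pre_frame_operator f c"
    unfolding pre_frame_operator_def by (rule summable_sums[OF bessel_summable[OF assms]])
  from bounded_linear.sums[OF bounded_linear_ip_left this, of x]
  show ?thesis
    by (simp add: ip_scale_left flip: ip_commute)
qed

text \<open>
  Testing the adjoint identity against the unit sequences determines every coordinate of the
  adjoint, which gives the uniqueness that the definite description requires.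
\<close>

lemma adjoint_pre_frame_operator:
  assumes "bessel B f"
  shows "adjoint_on l2 l2_inner ip (pre_frame_operator f) x = (\<lambda>i. ip x (f i))"
  unfolding adjoint_on_def
proof (rule the_equality)
  have adj: "ip (pre_frame_operator f c) x = l2_inner c (\<lambda>i. ip x (f i))" if "c \<in> l2" for c
    unfolding l2_inner_def by (rule sums_unique[OF ip_pre_frame_operator_sums[OF assms that]])
  then show "(\<lambda>i. ip x (f i)) \<in> l2 \<and>
      (\<forall>c\<in>l2. ip (pre_frame_operator f c) x = l2_inner c (\<lambda>i. ip x (f i)))"
    using assms by (simp add: bessel_def l2_def)
  fix z assume z: "z \<in> l2 \<and> (\<forall>c\<in>l2. ip (pre_frame_operator f c) x = l2_inner c z)"
  show "z = (\<lambda>i. ip x (f i))"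
  proof
    fix j
    define e where "e = (\<lambda>i::nat. if i = j then 1 else 0 :: 'k)"
    have e: "e \<in> l2"
      unfolding l2_def mem_Collect_eq
      by (rule summable_finite[of "{j}"]) (auto simp: e_def)
    have "l2_inner e w = kconj (w j)" for w
      unfolding l2_inner_def by (subst suminf_finite[of "{j}"]) (auto simp: e_def)
    then have "kconj (z j) = kconj (ip x (f j))"
      using z e adj by metis
    then show "z j = ip x (f j)"
      by (metis kconj_kconj)
  qed
qed

lemma cross_term_sums:
  assumes "bessel B f" and "bessel C g"
  shows "(\<lambda>i. ip x (g i) * kconj (ip x (f i))) sums
    ip (pre_frame_operator f (adjoint_on l2 l2_inner ip (pre_frame_operator g) x)) x"
  unfolding adjoint_pre_frame_operator[OF assms(2)]
  using assms by (intro ip_pre_frame_operator_sums) (auto simp: bessel_def l2_def)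

section \<open>Sums of frames\<close>

lemma k_frameE:
  assumes "k_frame K f"
  obtains A B where "0 < A" and "bessel B f"
    and "\<And>x. A * (norm (adjoint_on UNIV ip ip K x))\<^sup>2 \<le> (\<Sum>i. (norm (ip x (f i)))\<^sup>2)"
  using assms unfolding k_frame_def bessel_def by (meson less_imp_le order_trans)

lemma k_frameI:
  assumes "0 < A" and "bessel B f"
    and "\<And>x. A * (norm (adjoint_on UNIV ip ip K x))\<^sup>2 \<le> (\<Sum>i. (norm (ip x (f i)))\<^sup>2)"
  shows "k_frame K f"
proof -
  \<comment> \<open>A frame asks for ordered bounds, hence the maximum.\<close>
  have "(\<Sum>i. (norm (ip x (f i)))\<^sup>2) \<le> max A B * (norm x)\<^sup>2" for x
    using assms(2) unfolding bessel_def
    by (meson max.cobounded2 mult_right_mono order_trans zero_le_power2)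
  with assms show ?thesis
    unfolding k_frame_def bessel_def by (intro exI[of _ A] exI[of _ "max A B"]) auto
qed

lemma bessel_add:
  assumes "bessel B f" and "bessel C g"
  shows "bessel (2 * (B + C)) (\<lambda>i. f i + g i)"
  unfolding bessel_def
proof (intro conjI allI)
  show "0 \<le> 2 * (B + C)"
    using assms by (simp add: bessel_def)
  fix x
  have le: "(norm (ip x (f i + g i)))\<^sup>2 \<le> 2 * ((norm (ip x (f i)))\<^sup>2 + (norm (ip x (g i)))\<^sup>2)" for i
  proof -
    have "(norm (ip x (f i + g i)))\<^sup>2 \<le> (norm (ip x (f i)) + norm (ip x (g i)))\<^sup>2"
      by (simp add: ip_add_right norm_triangle_ineq power_mono)
    also have "\<dots> \<le> 2 * ((norm (ip x (f i)))\<^sup>2 + (norm (ip x (g i)))\<^sup>2)"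
      using sum_squares_bound[of "norm (ip x (f i))" "norm (ip x (g i))"]
      by (simp add: power2_sum)
    finally show ?thesis .
  qed
  have sf: "summable (\<lambda>i. (norm (ip x (f i)))\<^sup>2)" and sg: "summable (\<lambda>i. (norm (ip x (g i)))\<^sup>2)"
    using assms by (auto simp: bessel_def)
  note s = summable_mult[OF summable_add[OF sf sg], of 2]
  show s': "summable (\<lambda>i. (norm (ip x (f i + g i)))\<^sup>2)"
    by (rule summable_comparison_test'[OF s, of 0]) (use le in simp)
  have "(\<Sum>i. (norm (ip x (f i + g i)))\<^sup>2)
      \<le> (\<Sum>i. 2 * ((norm (ip x (f i)))\<^sup>2 + (norm (ip x (g i)))\<^sup>2))"
    by (rule suminf_le[OF le s' s])
  also have "\<dots> = 2 * ((\<Sum>i. (norm (ip x (f i)))\<^sup>2) + (\<Sum>i. (norm (ip x (g i)))\<^sup>2))"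
    by (simp add: suminf_mult summable_add suminf_add[symmetric] sf sg)
  also have "\<dots> \<le> 2 * (B * (norm x)\<^sup>2 + C * (norm x)\<^sup>2)"
    using assms by (intro mult_left_mono add_mono) (auto simp: bessel_def)
  finally show "(\<Sum>i. (norm (ip x (f i + g i)))\<^sup>2) \<le> 2 * (B + C) * (norm x)\<^sup>2"
    by (simp add: algebra_simps)
qed

text \<open>
  The lower bounds add because positivity makes the cross term in the expansion of the square
  nonnegative: only the total of the cross terms is controlled, individual ones may be negative.
\<close>

lemma k_frame_add:
  assumes "k_frame K f" and "k_frame K g"
    and pos: "positive_operator
      (pre_frame_operator f \<circ> adjoint_on l2 l2_inner ip (pre_frame_operator g))"
  shows "k_frame K (\<lambda>i. f i + g i)"
proof -
  obtain A B where A: "0 < A" and f: "bessel B f"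
    and Af: "\<And>x. A * (norm (adjoint_on UNIV ip ip K x))\<^sup>2 \<le> (\<Sum>i. (norm (ip x (f i)))\<^sup>2)"
    using k_frameE[OF assms(1)] by blast
  obtain A' B' where A': "0 < A'" and g: "bessel B' g"
    and Ag: "\<And>x. A' * (norm (adjoint_on UNIV ip ip K x))\<^sup>2 \<le> (\<Sum>i. (norm (ip x (g i)))\<^sup>2)"
    using k_frameE[OF assms(2)] by blast
  show ?thesis
  proof (rule k_frameI[OF _ bessel_add[OF f g]])
    show "0 < A + A'"
      using A A' by simp
    fix x
    define p where
      "p = ip (pre_frame_operator f (adjoint_on l2 l2_inner ip (pre_frame_operator g) x)) x"
    have "p \<in> \<real>\<^sub>\<ge>\<^sub>0"
      using pos by (simp add: positive_operator_def p_def)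
    then have p: "0 \<le> Re (to_complex p)"
      by (auto simp: nonneg_Reals_def to_complex_of_real)
    have "(\<lambda>i. Re (to_complex (ip x (g i) * kconj (ip x (f i))))) sums Re (to_complex p)"
      unfolding p_def
      by (intro bounded_linear.sums[OF bounded_linear_Re]
        bounded_linear.sums[OF bounded_linear_to_complex] cross_term_sums[OF f g])
    moreover have "(\<lambda>i. (norm (ip x (f i)))\<^sup>2) sums (\<Sum>i. (norm (ip x (f i)))\<^sup>2)"
      and "(\<lambda>i. (norm (ip x (g i)))\<^sup>2) sums (\<Sum>i. (norm (ip x (g i)))\<^sup>2)"
      using f g by (auto simp: bessel_def)
    ultimately have "(\<lambda>i. (norm (ip x (f i + g i)))\<^sup>2) sums
        ((\<Sum>i. (norm (ip x (f i)))\<^sup>2) + (\<Sum>i. (norm (ip x (g i)))\<^sup>2) + 2 * Re (to_complex p))"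
      unfolding ip_add_right norm_add_squared by (intro sums_add sums_mult)
    then have "(\<Sum>i. (norm (ip x (f i + g i)))\<^sup>2) =
        (\<Sum>i. (norm (ip x (f i)))\<^sup>2) + (\<Sum>i. (norm (ip x (g i)))\<^sup>2) + 2 * Re (to_complex p)"
      by (rule sums_unique[symmetric])
    then show "(A + A') * (norm (adjoint_on UNIV ip ip K x))\<^sup>2
        \<le> (\<Sum>i. (norm (ip x (f i + g i)))\<^sup>2)"
      using Af[of x] Ag[of x] p by (simp add: distrib_right)
  qed
qed

end

section \<open>Frames in an n-Hilbert space\<close>

theorem theorem3p7:
  fixes scale :: "'k::real_or_complex \<Rightarrow> 'a::ab_group_add \<Rightarrow> 'a"
    and n :: nat
    and nip :: "'a \<Rightarrow> 'a \<Rightarrow> 'a list \<Rightarrow> 'k"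
    and scaleF :: "'k \<Rightarrow> 'h::banach \<Rightarrow> 'h"
    and ipF :: "'h \<Rightarrow> 'h \<Rightarrow> 'k"
    and a :: "'a list"
    and emb :: "'a \<Rightarrow> 'h"
    and K :: "'h \<Rightarrow> 'h"
    and f g :: "nat \<Rightarrow> 'a"
    and T L :: "(nat \<Rightarrow> 'k) \<Rightarrow> 'h"
    and T' L' :: "'h \<Rightarrow> nat \<Rightarrow> 'k"
  assumes "associated_hilbert_space scale n nip scaleF ipF a emb"
    and "hilbert_space.bounded_operator scaleF K"
    and "hilbert_space.k_frame ipF K (\<lambda>i. emb (f i))"
    and "hilbert_space.k_frame ipF K (\<lambda>i. emb (g i))"
    and "T = hilbert_space.pre_frame_operator scaleF (\<lambda>i. emb (f i))"
    and "L = hilbert_space.pre_frame_operator scaleF (\<lambda>i. emb (g i))"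
    and "T' = adjoint_on l2 l2_inner ipF T"
    and "L' = adjoint_on l2 l2_inner ipF L"
    and "hilbert_space.positive_operator scaleF ipF (T \<circ> L')"
    and "hilbert_space.positive_operator scaleF ipF (L \<circ> T')"
  shows "hilbert_space.k_frame ipF K (\<lambda>i. emb (f i + g i))"
proof -
  interpret associated_hilbert_space scale n nip scaleF ipF a emb
    by (rule assms(1))
  interpret e: Vector_Spaces.linear scale scaleF emb
    by (rule linear_emb)
  show ?thesis
    using H.k_frame_add[OF assms(3,4)] assms(9) unfolding assms(5,6,8) e.add by simp
qed

end
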